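(* Let $O$ be a partial order on a set $X$ and $P$ a partial order on a set $Y$, where $X\cap Y=\emptyset$ (no finiteness is assumed). Consider: $\mathcal{Q}(O,P)=\{Q \text{ quasiorder on } X\cup Y \mid Q\cap(X\times X)=O,\ Q\cap(Y\times Y)=P,\ Q\cap(Y\times X)=\emptyset\}$, ordered by inclusion; $\mathcal{D}(O,P)$, the set of all maps $f:Y\to\mathcal{D}(O)$ that are isotone from $(Y,P)$ to $(\mathcal{D}(O),\subseteq)$, ordered pointwise; $\mathcal{U}(O,P)$, the set of all maps $g:X\to\mathcal{U}(P)$ that are antitone from $(X,O)$ to $(\mathcal{U}(P),\subseteq)$ (i.e. $x\,O\,x'$ implies $g(x')\subseteq g(x)$), ordered pointwise; $\mathcal{J}(O,P)$, the set of all maps $h:\mathcal{D}(P)\to\mathcal{D}(O)$ preserving arbitrary unions, ordered pointwise; $\mathcal{R}(O,P)=\{R\subseteq X\times Y\mid OR\cup RP\subseteq R\}$, ordered by inclusion; and the tensor product $\mathcal{U}(O)\otimes\mathcal{D}(P)$. Then each of these six ordered sets is a superalgebraic lattice, and all six are isomorphic to one another.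
   Context: For a partial order $O$ on $X$, $\mathcal{D}(O)$ denotes the set of downsets (subsets $D\subseteq X$ with $x\,O\,y\in D\Rightarrow x\in D$) and $\mathcal{U}(O)$ the set of upsets (defined dually), both ordered by inclusion. A quasiorder is a reflexive transitive relation. For relations $R\subseteq X\times Y$, $S\subseteq Y\times Z$, the composite is $RS=\{(x,z)\mid \exists y:\ (x,y)\in R,\ (y,z)\in S\}$. A superalgebraic lattice is a completely distributive algebraic lattice. For complete lattices $C,D$, the tensor product $C\otimes D$ is the complete lattice of all maps from $C$ to the order dual of $D$ that preserve arbitrary joins, ordered pointwise. *)

theory Defs
  imports "HOL-Algebra.Complete_Lattice"
begin

text \<open>
  Ordered sets are \<open>gorder\<close> records with equality as equivalence. Maps out of a set are taken
  extensional, so that a map on a carrier is a unique HOL function.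
\<close>

abbreviation incl_order :: "'a set set \<Rightarrow> 'a set gorder"
  where "incl_order \<A> \<equiv> \<lparr>carrier = \<A>, eq = (=), le = (\<subseteq>)\<rparr>"

abbreviation pointwise_order ::
    "'a set \<Rightarrow> ('b \<Rightarrow> 'b \<Rightarrow> bool) \<Rightarrow> ('a \<Rightarrow> 'b) set \<Rightarrow> ('a \<Rightarrow> 'b) gorder"
  where "pointwise_order X l F \<equiv> \<lparr>carrier = F, eq = (=), le = (\<lambda>f g. \<forall>x\<in>X. l (f x) (g x))\<rparr>"

definition order_isomorphic :: "('a, 'c) gorder_scheme \<Rightarrow> ('b, 'd) gorder_scheme \<Rightarrow> bool"
  where "order_isomorphic L M \<longleftrightarrow> (\<exists>f. bij_betw f (carrier L) (carrier M) \<and> order_emb L M f)"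


definition compact_elements :: "('a, 'c) gorder_scheme \<Rightarrow> 'a set"
  where "compact_elements L =
    {k \<in> carrier L. \<forall>A \<subseteq> carrier L. k \<sqsubseteq>\<^bsub>L\<^esub> \<Squnion>\<^bsub>L\<^esub> A \<longrightarrow>
      (\<exists>F \<subseteq> A. finite F \<and> k \<sqsubseteq>\<^bsub>L\<^esub> \<Squnion>\<^bsub>L\<^esub> F)}"

definition algebraic_lattice :: "('a, 'c) gorder_scheme \<Rightarrow> bool"
  where "algebraic_lattice L \<longleftrightarrow> complete_lattice L \<and>
    (\<forall>x \<in> carrier L. x = \<Squnion>\<^bsub>L\<^esub> {k \<in> compact_elements L. k \<sqsubseteq>\<^bsub>L\<^esub> x})"

text \<open>The choice functions are those of the class \<open>complete_distrib_lattice\<close>.\<close>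

definition completely_distributive :: "('a, 'c) gorder_scheme \<Rightarrow> bool"
  where "completely_distributive L \<longleftrightarrow> complete_lattice L \<and>
    (\<forall>\<A> \<subseteq> Pow (carrier L).
      \<Sqinter>\<^bsub>L\<^esub> ((\<lambda>A. \<Squnion>\<^bsub>L\<^esub> A) ` \<A>) = \<Squnion>\<^bsub>L\<^esub> {\<Sqinter>\<^bsub>L\<^esub> (f ` \<A>) |f. \<forall>A\<in>\<A>. f A \<in> A})"

definition superalgebraic_lattice :: "('a, 'c) gorder_scheme \<Rightarrow> bool"
  where "superalgebraic_lattice L \<longleftrightarrow> completely_distributive L \<and> algebraic_lattice L"


definition downsets :: "'a set \<Rightarrow> 'a rel \<Rightarrow> 'a set set"
  where "downsets X r = {D. D \<subseteq> X \<and> (\<forall>x y. (x, y) \<in> r \<and> y \<in> D \<longrightarrow> x \<in> D)}"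

definition upsets :: "'a set \<Rightarrow> 'a rel \<Rightarrow> 'a set set"
  where "upsets X r = {U. U \<subseteq> X \<and> (\<forall>x y. (x, y) \<in> r \<and> x \<in> U \<longrightarrow> y \<in> U)}"

text \<open>
  Both join preservation and the pointwise order refer to the codomain \<open>inv_gorder D\<close>:
  \<open>f\<close> is below \<open>g\<close> iff \<open>g c\<close> is below \<open>f c\<close> in \<open>D\<close> for all \<open>c\<close>.
\<close>

definition tensor_product ::
    "('a, 'c) gorder_scheme \<Rightarrow> ('b, 'd) gorder_scheme \<Rightarrow> ('a \<Rightarrow> 'b) gorder"
  where "tensor_product C D = pointwise_order (carrier C) (le (inv_gorder D))
    {f \<in> carrier C \<rightarrow>\<^sub>E carrier (inv_gorder D). sup_pres C (inv_gorder D) f}"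


text \<open>In the following, \<open>r\<close> is the order on \<open>X\<close> and \<open>s\<close> the order on \<open>Y\<close>.\<close>

definition quasiorder_extensions :: "'a set \<Rightarrow> 'a rel \<Rightarrow> 'a set \<Rightarrow> 'a rel \<Rightarrow> 'a rel gorder"
  where "quasiorder_extensions X r Y s = incl_order
    {Q. preorder_on (X \<union> Y) Q \<and> Q \<inter> (X \<times> X) = r \<and> Q \<inter> (Y \<times> Y) = s \<and> Q \<inter> (Y \<times> X) = {}}"

definition isotone_downset_maps ::
    "'a set \<Rightarrow> 'a rel \<Rightarrow> 'a set \<Rightarrow> 'a rel \<Rightarrow> ('a \<Rightarrow> 'a set) gorder"
  where "isotone_downset_maps X r Y s = pointwise_order Y (\<subseteq>)
    {f \<in> Y \<rightarrow>\<^sub>E downsets X r. monotone_on Y (\<lambda>y y'. (y, y') \<in> s) (\<subseteq>) f}"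

definition antitone_upset_maps ::
    "'a set \<Rightarrow> 'a rel \<Rightarrow> 'a set \<Rightarrow> 'a rel \<Rightarrow> ('a \<Rightarrow> 'a set) gorder"
  where "antitone_upset_maps X r Y s = pointwise_order X (\<subseteq>)
    {g \<in> X \<rightarrow>\<^sub>E upsets Y s. monotone_on X (\<lambda>x x'. (x, x') \<in> r) (\<supseteq>) g}"

definition union_preserving_maps ::
    "'a set \<Rightarrow> 'a rel \<Rightarrow> 'a set \<Rightarrow> 'a rel \<Rightarrow> ('a set \<Rightarrow> 'a set) gorder"
  where "union_preserving_maps X r Y s = pointwise_order (downsets Y s) (\<subseteq>)
    {h \<in> downsets Y s \<rightarrow>\<^sub>E downsets X r. \<forall>\<A> \<subseteq> downsets Y s. h (\<Union>\<A>) = \<Union>(h ` \<A>)}"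

definition stable_relations :: "'a set \<Rightarrow> 'a rel \<Rightarrow> 'a set \<Rightarrow> 'a rel \<Rightarrow> 'a rel gorder"
  where "stable_relations X r Y s = incl_order {R. R \<subseteq> X \<times> Y \<and> r O R \<union> R O s \<subseteq> R}"

definition upset_downset_tensor ::
    "'a set \<Rightarrow> 'a rel \<Rightarrow> 'a set \<Rightarrow> 'a rel \<Rightarrow> ('a set \<Rightarrow> 'a set) gorder"
  where "upset_downset_tensor X r Y s =
    tensor_product (incl_order (upsets X r)) (incl_order (downsets Y s))"

end

theory Submission
  imports Defs
begin

text \<open>
  The stable relations form a family of subsets of \<open>X \<times> Y\<close> closed under arbitrary unions and
  intersections. Every lattice isomorphic to such a family is superalgebraic: complete
  distributivity is inherited from the power set, and the least members containing a given point
  are completely join-prime, hence compact, and generate the family.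

  A stable relation \<open>R\<close> amounts to the quasiorder \<open>r \<union> s \<union> R\<close>, and it is determined by its
  columns, which form an isotone map from \<open>Y\<close> to the downsets of \<open>X\<close>. Such a map extends uniquely
  to a union-preserving map on the downsets of \<open>Y\<close>, since these are the free join-completion of
  \<open>Y\<close>. Antitone maps and the tensor product are then obtained by passing to the converse relations,
  the latter after complementing values in \<open>Y\<close>.
\<close>

section \<open>Ordered sets\<close>

lemma order_isomorphicI:
  assumes "isotone L M f" and "isotone M L g"
    and "f \<in> carrier L \<rightarrow> carrier M" and "g \<in> carrier M \<rightarrow> carrier L"
    and "\<And>x. x \<in> carrier L \<Longrightarrow> g (f x) = x" and "\<And>y. y \<in> carrier M \<Longrightarrow> f (g y) = y"
  shows "order_isomorphic L M"
proof -
  have "bij_betw f (carrier L) (carrier M)"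
    by (rule bij_betw_byWitness [where f' = g]) (use assms(3-6) in auto)
  moreover have "f x \<sqsubseteq>\<^bsub>M\<^esub> f y \<longleftrightarrow> x \<sqsubseteq>\<^bsub>L\<^esub> y" if "x \<in> carrier L" "y \<in> carrier L" for x y
    using that assms use_iso2 [OF assms(1), of x y] use_iso2 [OF assms(2), of "f x" "f y"]
    by (auto simp: Pi_iff)
  ultimately show ?thesis
    using assms(1) unfolding order_isomorphic_def order_emb_def isotone_def by blast
qed

lemma order_isomorphic_refl:
  assumes "weak_partial_order L"
  shows "order_isomorphic L L"
  by (rule order_isomorphicI [where f = id and g = id])
    (use assms in \<open>simp_all add: isotone_def\<close>)

lemma order_isomorphic_sym:
  assumes "order_isomorphic L M"
  shows "order_isomorphic M L"
proof -
  from assms obtain f where f: "bij_betw f (carrier L) (carrier M)" and emb: "order_emb L M f"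
    unfolding order_isomorphic_def by blast
  define g where "g = inv_into (carrier L) f"
  have g: "g \<in> carrier M \<rightarrow> carrier L"
    using bij_betw_apply [OF bij_betw_inv_into [OF f]] by (auto simp: g_def)
  have fg: "f (g y) = y" if "y \<in> carrier M" for y
    using f that by (simp add: g_def bij_betw_inv_into_right)
  show ?thesis
  proof (rule order_isomorphicI)
    show "isotone M L g"
      using emb g fg unfolding order_emb_def isotone_def by (metis Pi_mem)
    show "isotone L M f"
      using emb by (rule order_emb_isotone)
    show "f \<in> carrier L \<rightarrow> carrier M"
      using bij_betw_apply [OF f] by blast
    show "g (f x) = x" if "x \<in> carrier L" for x
      using f that by (simp add: g_def bij_betw_inv_into_left)
  qed (use g fg in auto)
qed

lemma order_isomorphic_trans [trans]:
  assumes "order_isomorphic L M" and "order_isomorphic M N"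
  shows "order_isomorphic L N"
proof -
  from assms obtain f g
    where f: "bij_betw f (carrier L) (carrier M)" "order_emb L M f"
      and g: "bij_betw g (carrier M) (carrier N)" "order_emb M N g"
    unfolding order_isomorphic_def by blast
  have "order_emb L N (g \<circ> f)"
    using f(2) g(2) bij_betw_apply [OF f(1)] unfolding order_emb_def by simp
  with bij_betw_trans [OF f(1) g(1)] show ?thesis
    unfolding order_isomorphic_def by blast
qed

lemma isotone_partial_orderI:
  assumes "partial_order L" and "partial_order M"
    and "\<And>x y. x \<in> carrier L \<Longrightarrow> y \<in> carrier L \<Longrightarrow> x \<sqsubseteq>\<^bsub>L\<^esub> y \<Longrightarrow> f x \<sqsubseteq>\<^bsub>M\<^esub> f y"
  shows "isotone L M f"
  by (rule isotoneI [OF partial_order.axioms(1) partial_order.axioms(1)]) (fact assms)+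

lemma (in complete_lattice) dual_complete_lattice: "complete_lattice (inv_gorder L)"
proof -
  interpret dual: partial_order "inv_gorder L" by (rule dual_order)
  show ?thesis
    by unfold_locales (use inf_exists sup_exists in auto)
qed

lemma partial_order_incl_order: "partial_order (incl_order \<A>)"
  by unfold_locales auto

lemma partial_order_pointwise_order:
  assumes "partial_order M" and "F \<subseteq> A \<rightarrow>\<^sub>E carrier M"
  shows "partial_order (pointwise_order A (le M) F)"
proof -
  interpret M: partial_order M by (rule assms(1))
  have closed: "f x \<in> carrier M" if "f \<in> F" "x \<in> A" for f x
    using assms(2) that by auto
  show ?thesis
  proof unfold_locales
    fix f g assume le: "f \<sqsubseteq>\<^bsub>pointwise_order A (le M) F\<^esub> g" "g \<sqsubseteq>\<^bsub>pointwise_order A (le M) F\<^esub> f"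
      and F: "f \<in> carrier (pointwise_order A (le M) F)" "g \<in> carrier (pointwise_order A (le M) F)"
    have "f = g"
    proof (rule PiE_ext)
      show "f \<in> A \<rightarrow>\<^sub>E carrier M" "g \<in> A \<rightarrow>\<^sub>E carrier M" using F assms(2) by auto
      show "f x = g x" if "x \<in> A" for x using le F closed that by (simp add: M.le_antisym)
    qed
    then show "f .=\<^bsub>pointwise_order A (le M) F\<^esub> g" by simp
  qed (auto intro: closed M.le_trans)
qed

section \<open>Complete rings of sets\<close>

locale complete_ring_of_sets =
  fixes \<S> :: "'a set set" and Z :: "'a set"
  assumes subset_top: "S \<in> \<S> \<Longrightarrow> S \<subseteq> Z"
    and Union_closed: "\<A> \<subseteq> \<S> \<Longrightarrow> \<Union>\<A> \<in> \<S>"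
    and Inter_closed: "\<A> \<subseteq> \<S> \<Longrightarrow> Z \<inter> \<Inter>\<A> \<in> \<S>"
begin

definition least_member :: "'a \<Rightarrow> 'a set"
  where "least_member z = Z \<inter> \<Inter>{S \<in> \<S>. z \<in> S}"

lemma least_member_closed: "least_member z \<in> \<S>"
  unfolding least_member_def by (rule Inter_closed) auto

lemma mem_least_member: "z \<in> Z \<Longrightarrow> z \<in> least_member z"
  by (simp add: least_member_def)

lemma least_member_subset_iff:
  assumes "S \<in> \<S>" and "z \<in> Z"
  shows "least_member z \<subseteq> S \<longleftrightarrow> z \<in> S"
  using assms mem_least_member by (auto simp: least_member_def)

end

locale set_representation = partial_order L + complete_ring_of_sets \<S> Z
  for L (structure) and \<S> :: "'b set set" and Z +
  fixes \<phi> :: "'a \<Rightarrow> 'b set"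
  assumes bij: "bij_betw \<phi> (carrier L) \<S>"
    and le_iff: "x \<in> carrier L \<Longrightarrow> y \<in> carrier L \<Longrightarrow> x \<sqsubseteq> y \<longleftrightarrow> \<phi> x \<subseteq> \<phi> y"
begin

lemma repr_closed: "x \<in> carrier L \<Longrightarrow> \<phi> x \<in> \<S>"
  using bij by (rule bij_betw_apply)

lemma repr_surj:
  assumes "S \<in> \<S>"
  shows "\<exists>x\<in>carrier L. \<phi> x = S"
  using assms bij_betw_imp_surj_on [OF bij] by blast

lemma repr_eqD: "\<phi> x = \<phi> y \<Longrightarrow> x \<in> carrier L \<Longrightarrow> y \<in> carrier L \<Longrightarrow> x = y"
  using bij_betw_imp_inj_on [OF bij] by (rule inj_onD)

lemma is_lub_if_repr_eq_Union:
  assumes "A \<subseteq> carrier L" and "s \<in> carrier L" and "\<phi> s = \<Union>(\<phi> ` A)"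
  shows "is_lub L s A"
proof (rule least_UpperI)
  fix y assume "y \<in> Upper L A"
  with assms(1) have "y \<in> carrier L" "\<forall>x\<in>A. x \<sqsubseteq> y"
    unfolding Upper_def by auto
  with assms show "s \<sqsubseteq> y" by (auto simp: le_iff subset_iff)
qed (use assms in \<open>auto simp: le_iff subset_iff\<close>)

lemma is_glb_if_repr_eq_Inter:
  assumes "A \<subseteq> carrier L" and "i \<in> carrier L" and "\<phi> i = Z \<inter> \<Inter>(\<phi> ` A)"
  shows "is_glb L i A"
proof (rule greatest_LowerI)
  fix y assume "y \<in> Lower L A"
  with assms(1) have "y \<in> carrier L" "\<forall>x\<in>A. y \<sqsubseteq> x"
    unfolding Lower_def by auto
  with assms subset_top [OF repr_closed, of y] show "y \<sqsubseteq> i"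
    by (auto simp: le_iff subset_iff)
qed (use assms in \<open>auto simp: le_iff subset_iff\<close>)

lemma repr_Union_exists:
  assumes "A \<subseteq> carrier L"
  shows "\<exists>s\<in>carrier L. \<phi> s = \<Union>(\<phi> ` A)"
proof -
  have "\<Union>(\<phi> ` A) \<in> \<S>"
    using assms repr_closed by (intro Union_closed) auto
  then show ?thesis by (rule repr_surj)
qed

lemma repr_Inter_exists:
  assumes "A \<subseteq> carrier L"
  shows "\<exists>i\<in>carrier L. \<phi> i = Z \<inter> \<Inter>(\<phi> ` A)"
proof -
  have "Z \<inter> \<Inter>(\<phi> ` A) \<in> \<S>"
    using assms repr_closed by (intro Inter_closed) auto
  then show ?thesis by (rule repr_surj)
qed

sublocale complete_lattice L
proof unfold_locales
  show "\<exists>s. is_lub L s A" if "A \<subseteq> carrier L" for A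
    using that repr_Union_exists is_lub_if_repr_eq_Union by blast
  show "\<exists>i. is_glb L i A" if "A \<subseteq> carrier L" for A
    using that repr_Inter_exists is_glb_if_repr_eq_Inter by blast
qed

lemma repr_sup:
  assumes "A \<subseteq> carrier L"
  shows "\<phi> (\<Squnion>A) = \<Union>(\<phi> ` A)"
proof -
  obtain s where s: "s \<in> carrier L" "\<phi> s = \<Union>(\<phi> ` A)"
    using repr_Union_exists [OF assms] by blast
  then have "\<Squnion>A = s"
    using least_unique [OF sup_lub is_lub_if_repr_eq_Union] assms by blast
  with s(2) show ?thesis by simp
qed

lemma repr_inf:
  assumes "A \<subseteq> carrier L"
  shows "\<phi> (\<Sqinter>A) = Z \<inter> \<Inter>(\<phi> ` A)"
proof -
  obtain i where i: "i \<in> carrier L" "\<phi> i = Z \<inter> \<Inter>(\<phi> ` A)"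
    using repr_Inter_exists [OF assms] by blast
  then have "\<Sqinter>A = i"
    using greatest_unique [OF inf_glb is_glb_if_repr_eq_Inter] assms by blast
  with i(2) show ?thesis by simp
qed

lemma completely_distributive: "completely_distributive L"
  unfolding completely_distributive_def
proof (intro conjI allI impI)
  fix \<A> assume \<A>: "\<A> \<subseteq> Pow (carrier L)"
  let ?choices = "{f ` \<A> |f. \<forall>A\<in>\<A>. f A \<in> A}"
  let ?infs = "{\<Sqinter>(f ` \<A>) |f. \<forall>A\<in>\<A>. f A \<in> A}"
  have sups: "(\<lambda>A. \<Squnion>A) ` \<A> \<subseteq> carrier L"
    using \<A> by auto
  have choices: "B \<subseteq> carrier L" if "B \<in> ?choices" for B
    using \<A> that by auto
  have infs: "?infs = (\<lambda>B. \<Sqinter>B) ` ?choices"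
    by blast
  have infs_closed: "?infs \<subseteq> carrier L"
    unfolding infs by (intro image_subsetI inf_closed choices)
  have "\<phi> (\<Sqinter>((\<lambda>A. \<Squnion>A) ` \<A>)) = Z \<inter> (\<Inter>A\<in>\<A>. \<Union>(\<phi> ` A))"
    using repr_inf [OF sups] repr_sup \<A> by (simp add: image_image subset_iff)
  also have "\<dots> = (\<Union>B\<in>?choices. Z \<inter> \<Inter>(\<phi> ` B))"
    by (simp only: INF_SUP_set Int_UN_distrib)
  also have "\<dots> = (\<Union>B\<in>?choices. \<phi> (\<Sqinter>B))"
    by (rule SUP_cong [OF HOL.refl]) (rule repr_inf [OF choices, symmetric])
  also have "\<dots> = \<phi> (\<Squnion>?infs)"
    unfolding repr_sup [OF infs_closed] unfolding infs by (simp only: image_image)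
  finally show "\<Sqinter>((\<lambda>A. \<Squnion>A) ` \<A>) = \<Squnion>?infs"
    by (intro repr_eqD inf_closed sup_closed sups infs_closed)
qed (rule complete_lattice_axioms)

lemma compact_if_repr_eq_least_member:
  assumes k: "k \<in> carrier L" and "z \<in> Z" and "\<phi> k = least_member z"
  shows "k \<in> compact_elements L"
  unfolding compact_elements_def
proof (intro CollectI conjI allI impI)
  fix A assume A: "A \<subseteq> carrier L" "k \<sqsubseteq> \<Squnion>A"
  then have "\<phi> k \<subseteq> \<Union>(\<phi> ` A)"
    using le_iff [OF k sup_closed] repr_sup by simp
  moreover have "z \<in> \<phi> k"
    using assms mem_least_member by simp
  ultimately obtain a where a: "a \<in> A" "z \<in> \<phi> a"
    by auto
  with A(1) have "a \<in> carrier L" by auto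
  with assms a(2) have "k \<sqsubseteq> a"
    using le_iff least_member_subset_iff [OF repr_closed] by metis
  moreover have "\<Squnion>{a} = a"
    using \<open>a \<in> carrier L\<close> by (rule sup_of_singleton)
  ultimately show "\<exists>F\<subseteq>A. finite F \<and> k \<sqsubseteq> \<Squnion>F"
    using a(1) by (intro exI [of _ "{a}"]) simp
qed (rule k)

lemma algebraic: "algebraic_lattice L"
  unfolding algebraic_lattice_def
proof (intro conjI ballI)
  fix x assume x: "x \<in> carrier L"
  let ?K = "{k \<in> compact_elements L. k \<sqsubseteq> x}"
  have K: "?K \<subseteq> carrier L"
    by (auto simp: compact_elements_def)
  have "\<phi> x \<subseteq> \<Union>(\<phi> ` ?K)"
  proof
    fix z assume z: "z \<in> \<phi> x"
    with x have "z \<in> Z" using subset_top [OF repr_closed] by auto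
    obtain k where k: "k \<in> carrier L" "\<phi> k = least_member z"
      using repr_surj [OF least_member_closed] by blast
    with x z \<open>z \<in> Z\<close> have "k \<sqsubseteq> x"
      using le_iff least_member_subset_iff [OF repr_closed] by metis
    moreover have "k \<in> compact_elements L"
      using k(1) \<open>z \<in> Z\<close> k(2) by (rule compact_if_repr_eq_least_member)
    moreover have "z \<in> \<phi> k"
      using k(2) mem_least_member [OF \<open>z \<in> Z\<close>] by simp
    ultimately show "z \<in> \<Union>(\<phi> ` ?K)"
      by blast
  qed
  moreover have "\<phi> k \<subseteq> \<phi> x" if "k \<in> ?K" for k
    using that K x le_iff [of k x] by blast
  then have "\<Union>(\<phi> ` ?K) \<subseteq> \<phi> x"
    by (rule UN_least)
  ultimately have "\<phi> x = \<phi> (\<Squnion>?K)"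
    unfolding repr_sup [OF K] by (rule subset_antisym)
  then show "x = \<Squnion>?K"
    using x sup_closed [OF K] by (rule repr_eqD)
qed (rule complete_lattice_axioms)

end

lemma (in complete_ring_of_sets) set_representation_incl_order:
  "set_representation (incl_order \<S>) \<S> Z (\<lambda>S. S)"
  by (intro set_representation.intro set_representation_axioms.intro partial_order_incl_order
      complete_ring_of_sets_axioms) (simp_all add: bij_betw_def)

lemma (in complete_ring_of_sets) superalgebraic_lattice_if_order_isomorphic:
  assumes "partial_order L" and "order_isomorphic L (incl_order \<S>)"
  shows "superalgebraic_lattice L"
proof -
  from assms(2) obtain \<phi> where "bij_betw \<phi> (carrier L) \<S>" and "order_emb L (incl_order \<S>) \<phi>"
    unfolding order_isomorphic_def by auto
  then interpret set_representation L \<S> Z \<phi>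
    using assms(1) complete_ring_of_sets_axioms
    by (simp add: set_representation_def set_representation_axioms_def order_emb_def)
  show ?thesis
    unfolding superalgebraic_lattice_def using completely_distributive algebraic ..
qed

section \<open>Union-preserving maps and tensor products\<close>

definition union_homs :: "'a set set \<Rightarrow> 'b set set \<Rightarrow> ('a set \<Rightarrow> 'b set) gorder"
  where "union_homs \<S> \<T> = pointwise_order \<S> (\<subseteq>)
    {h \<in> \<S> \<rightarrow>\<^sub>E \<T>. \<forall>\<A>\<subseteq>\<S>. h (\<Union>\<A>) = \<Union>(h ` \<A>)}"

lemma partial_order_union_homs: "partial_order (union_homs \<S> \<T>)"
  unfolding union_homs_def
  using partial_order_pointwise_order [OF partial_order_incl_order, of _ \<S> \<T>] by simp

lemma partial_order_tensor_product:
  assumes "partial_order D"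
  shows "partial_order (tensor_product C D)"
  unfolding tensor_product_def
  by (rule partial_order_pointwise_order) (use assms in \<open>auto simp: dual_order_iff\<close>)

lemma sup_pres_inv_incl_order_iff:
  assumes \<S>: "complete_ring_of_sets \<S> Z" and \<T>: "complete_ring_of_sets \<T> W" and f: "f \<in> \<S> \<rightarrow> \<T>"
  shows "sup_pres (incl_order \<S>) (inv_gorder (incl_order \<T>)) f \<longleftrightarrow>
    (\<forall>\<A>\<subseteq>\<S>. f (\<Union>\<A>) = W \<inter> \<Inter>(f ` \<A>))"
proof -
  interpret S: set_representation "incl_order \<S>" \<S> Z "\<lambda>S. S"
    by (rule complete_ring_of_sets.set_representation_incl_order [OF \<S>])
  interpret T: set_representation "incl_order \<T>" \<T> W "\<lambda>T. T"
    by (rule complete_ring_of_sets.set_representation_incl_order [OF \<T>])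
  have "f (\<Squnion>\<^bsub>incl_order \<S>\<^esub> \<A>) = \<Squnion>\<^bsub>inv_gorder (incl_order \<T>)\<^esub> (f ` \<A>) \<longleftrightarrow>
      f (\<Union>\<A>) = W \<inter> \<Inter>(f ` \<A>)" if "\<A> \<subseteq> \<S>" for \<A>
  proof -
    have "f ` \<A> \<subseteq> \<T>" using f that by auto
    with that show ?thesis
      unfolding sup_dual using S.repr_sup [of \<A>] T.repr_inf [of "f ` \<A>"] by simp
  qed
  then show ?thesis
    unfolding sup_pres_def using S.complete_lattice_axioms T.dual_complete_lattice by auto
qed

definition union_inter_homs ::
    "'a set set \<Rightarrow> 'b set \<Rightarrow> 'b set set \<Rightarrow> ('a set \<Rightarrow> 'b set) gorder"
  where "union_inter_homs \<S> W \<T> = pointwise_order \<S> (\<supseteq>)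
    {f \<in> \<S> \<rightarrow>\<^sub>E \<T>. \<forall>\<A>\<subseteq>\<S>. f (\<Union>\<A>) = W \<inter> \<Inter>(f ` \<A>)}"

lemma tensor_product_incl_order:
  assumes "complete_ring_of_sets \<S> Z" and "complete_ring_of_sets \<T> W"
  shows "tensor_product (incl_order \<S>) (incl_order \<T>) = union_inter_homs \<S> W \<T>"
proof -
  have "{f \<in> \<S> \<rightarrow>\<^sub>E \<T>. sup_pres (incl_order \<S>) (inv_gorder (incl_order \<T>)) f} =
      {f \<in> \<S> \<rightarrow>\<^sub>E \<T>. \<forall>\<A>\<subseteq>\<S>. f (\<Union>\<A>) = W \<inter> \<Inter>(f ` \<A>)}"
    using sup_pres_inv_incl_order_iff [OF assms]
    by (intro Collect_cong conj_cong refl) (auto simp: PiE_def)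
  then show ?thesis
    by (simp add: tensor_product_def union_inter_homs_def)
qed

definition pointwise_complement :: "'a set \<Rightarrow> 'b set \<Rightarrow> ('a \<Rightarrow> 'b set) \<Rightarrow> 'a \<Rightarrow> 'b set"
  where "pointwise_complement A W f = (\<lambda>x\<in>A. W - f x)"

lemma pointwise_complement_involution:
  assumes "f \<in> extensional A" and "\<And>x. x \<in> A \<Longrightarrow> f x \<subseteq> W"
  shows "pointwise_complement A W (pointwise_complement A W f) = f"
  by (rule extensionalityI [of _ A])
    (use assms in \<open>auto simp: pointwise_complement_def double_diff\<close>)

lemma pointwise_complement_Union:
  assumes "\<A> \<subseteq> \<S>" and "\<Union>\<A> \<in> \<S>"
  shows "f (\<Union>\<A>) = W \<inter> \<Inter>(f ` \<A>) \<Longrightarrow>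
      pointwise_complement \<S> W f (\<Union>\<A>) = \<Union>(pointwise_complement \<S> W f ` \<A>)"
    and "f (\<Union>\<A>) = \<Union>(f ` \<A>) \<Longrightarrow>
      pointwise_complement \<S> W f (\<Union>\<A>) = W \<inter> \<Inter>(pointwise_complement \<S> W f ` \<A>)"
  using assms by (auto simp: pointwise_complement_def subset_iff)

lemma pointwise_complement_union_inter_hom:
  assumes \<S>: "\<And>\<A>. \<A> \<subseteq> \<S> \<Longrightarrow> \<Union>\<A> \<in> \<S>" and f: "f \<in> carrier (union_inter_homs \<S> W \<T>)"
  shows "pointwise_complement \<S> W f \<in> carrier (union_homs \<S> ((\<lambda>T. W - T) ` \<T>))"
proof -
  have "pointwise_complement \<S> W f \<in> \<S> \<rightarrow>\<^sub>E (\<lambda>T. W - T) ` \<T>"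
    using f by (auto simp: union_inter_homs_def pointwise_complement_def)
  moreover have "\<forall>\<A>\<subseteq>\<S>. pointwise_complement \<S> W f (\<Union>\<A>) =
      \<Union>(pointwise_complement \<S> W f ` \<A>)"
    using f \<S> by (intro allI impI pointwise_complement_Union(1)) (auto simp: union_inter_homs_def)
  ultimately show ?thesis
    by (simp add: union_homs_def)
qed

lemma pointwise_complement_union_hom:
  assumes \<S>: "\<And>\<A>. \<A> \<subseteq> \<S> \<Longrightarrow> \<Union>\<A> \<in> \<S>" and \<T>: "\<And>T. T \<in> \<T> \<Longrightarrow> T \<subseteq> W"
    and h: "h \<in> carrier (union_homs \<S> ((\<lambda>T. W - T) ` \<T>))"
  shows "pointwise_complement \<S> W h \<in> carrier (union_inter_homs \<S> W \<T>)"
proof -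
  have "W - h S \<in> \<T>" if "S \<in> \<S>" for S
  proof -
    have "h S \<in> (\<lambda>T. W - T) ` \<T>"
      using h that by (auto simp: union_homs_def)
    then show ?thesis
      using \<T> by (auto simp: double_diff)
  qed
  then have "pointwise_complement \<S> W h \<in> \<S> \<rightarrow>\<^sub>E \<T>"
    by (auto simp: pointwise_complement_def)
  moreover have "\<forall>\<A>\<subseteq>\<S>. pointwise_complement \<S> W h (\<Union>\<A>) =
      W \<inter> \<Inter>(pointwise_complement \<S> W h ` \<A>)"
    using h \<S> by (intro allI impI pointwise_complement_Union(2)) (auto simp: union_homs_def)
  ultimately show ?thesis
    by (simp add: union_inter_homs_def)
qed

lemma tensor_product_order_isomorphic_union_homs:
  assumes \<S>: "complete_ring_of_sets \<S> Z" and \<T>: "complete_ring_of_sets \<T> W"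
  shows "order_isomorphic (tensor_product (incl_order \<S>) (incl_order \<T>))
    (union_homs \<S> ((\<lambda>T. W - T) ` \<T>))"
    (is "order_isomorphic ?L ?M")
proof (rule order_isomorphicI)
  let ?complement = "pointwise_complement \<S> W"
  note tensor_eq = tensor_product_incl_order [OF \<S> \<T>]
  note \<S>_Union = complete_ring_of_sets.Union_closed [OF \<S>]
    and \<T>_subset = complete_ring_of_sets.subset_top [OF \<T>]
  have orders: "partial_order ?L" "partial_order ?M"
    by (rule partial_order_tensor_product partial_order_incl_order partial_order_union_homs)+
  show "isotone ?L ?M ?complement"
    by (rule isotone_partial_orderI [OF orders])
      (auto simp: tensor_eq union_inter_homs_def union_homs_def pointwise_complement_def)
  show "isotone ?M ?L ?complement"
    by (rule isotone_partial_orderI [OF orders(2,1)])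
      (auto simp: tensor_eq union_inter_homs_def union_homs_def pointwise_complement_def)
  show "?complement \<in> carrier ?L \<rightarrow> carrier ?M"
    unfolding tensor_eq using pointwise_complement_union_inter_hom [OF \<S>_Union] by blast
  show "?complement \<in> carrier ?M \<rightarrow> carrier ?L"
    unfolding tensor_eq using pointwise_complement_union_hom [OF \<S>_Union \<T>_subset] by blast
  show "?complement (?complement f) = f" if "f \<in> carrier ?L" for f
    using that \<T>_subset
    by (intro pointwise_complement_involution) (auto simp: tensor_eq union_inter_homs_def PiE_def)
  show "?complement (?complement h) = h" if "h \<in> carrier ?M" for h
    using that by (intro pointwise_complement_involution) (auto simp: union_homs_def PiE_iff)
qed

section \<open>Downsets as the free join-completion\<close>

lemma downsets_converse: "downsets X (r\<inverse>) = upsets X r"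
  by (auto simp: downsets_def upsets_def)

lemma complete_ring_of_sets_downsets:
  assumes "r \<subseteq> X \<times> X"
  shows "complete_ring_of_sets (downsets X r) X"
  unfolding downsets_def by unfold_locales (use assms in blast)+

lemma complete_ring_of_sets_upsets:
  assumes "r \<subseteq> X \<times> X"
  shows "complete_ring_of_sets (upsets X r) X"
  using complete_ring_of_sets_downsets [of "r\<inverse>" X] assms by (auto simp: downsets_converse)

lemma Union_downsets_closed: "\<A> \<subseteq> downsets X r \<Longrightarrow> \<Union>\<A> \<in> downsets X r"
  unfolding downsets_def by blast

lemma complements_of_downsets:
  assumes "r \<subseteq> X \<times> X"
  shows "(\<lambda>D. X - D) ` downsets X r = upsets X r"
proof
  show "(\<lambda>D. X - D) ` downsets X r \<subseteq> upsets X r"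
    using assms by (auto simp: downsets_def upsets_def)
  show "upsets X r \<subseteq> (\<lambda>D. X - D) ` downsets X r"
  proof
    fix U assume "U \<in> upsets X r"
    then have "U = X - (X - U)" and "X - U \<in> downsets X r"
      using assms by (auto simp: downsets_def upsets_def)
    then show "U \<in> (\<lambda>D. X - D) ` downsets X r" by (rule image_eqI)
  qed
qed

definition principal_downset :: "'a rel \<Rightarrow> 'a \<Rightarrow> 'a set"
  where "principal_downset r x = r\<inverse> `` {x}"

lemma mem_principal_downset_iff: "x \<in> principal_downset r y \<longleftrightarrow> (x, y) \<in> r"
  by (simp add: principal_downset_def)

lemma principal_downset_closed:
  assumes "preorder_on X r"
  shows "principal_downset r x \<in> downsets X r"
  using assms unfolding preorder_on_def downsets_def
  by (auto simp: mem_principal_downset_iff dest: transD)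

lemma downset_eq_Union_principal_downsets:
  assumes "preorder_on X r" and "D \<in> downsets X r"
  shows "D = \<Union>(principal_downset r ` D)"
  using assms
  unfolding preorder_on_def refl_on_def downsets_def principal_downset_def by blast

definition isotone_homs :: "'a set \<Rightarrow> 'a rel \<Rightarrow> 'b set set \<Rightarrow> ('a \<Rightarrow> 'b set) gorder"
  where "isotone_homs X r \<S> = pointwise_order X (\<subseteq>)
    {f \<in> X \<rightarrow>\<^sub>E \<S>. monotone_on X (\<lambda>x x'. (x, x') \<in> r) (\<subseteq>) f}"

lemma partial_order_isotone_homs: "partial_order (isotone_homs X r \<S>)"
  unfolding isotone_homs_def
  using partial_order_pointwise_order [OF partial_order_incl_order, of _ X \<S>] by simp

lemma union_hom_mono:
  assumes "\<And>\<A>. \<A> \<subseteq> \<S> \<Longrightarrow> h (\<Union>\<A>) = \<Union>(h ` \<A>)" and "S \<in> \<S>" "T \<in> \<S>" "S \<subseteq> T"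
  shows "h S \<subseteq> h T"
proof -
  have "h T = h (\<Union>{S, T})" using assms(4) by (simp add: Un_absorb1)
  also have "\<dots> = h S \<union> h T" using assms(1) [of "{S, T}"] assms(2,3) by simp
  finally show ?thesis by blast
qed

definition principal_restriction :: "'a set \<Rightarrow> 'a rel \<Rightarrow> ('a set \<Rightarrow> 'b set) \<Rightarrow> 'a \<Rightarrow> 'b set"
  where "principal_restriction X r h = (\<lambda>x\<in>X. h (principal_downset r x))"

definition downset_extension :: "'a set \<Rightarrow> 'a rel \<Rightarrow> ('a \<Rightarrow> 'b set) \<Rightarrow> 'a set \<Rightarrow> 'b set"
  where "downset_extension X r f = (\<lambda>D\<in>downsets X r. \<Union>(f ` D))"

lemma principal_restriction_closed:
  assumes r: "preorder_on X r" and h: "h \<in> carrier (union_homs (downsets X r) \<S>)"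
  shows "principal_restriction X r h \<in> carrier (isotone_homs X r \<S>)"
proof -
  note principal = principal_downset_closed [OF r]
  have "h (principal_downset r x) \<subseteq> h (principal_downset r x')" if "(x, x') \<in> r" for x x'
  proof (rule union_hom_mono [OF _ principal principal])
    show "principal_downset r x \<subseteq> principal_downset r x'"
      using r that by (auto simp: preorder_on_def mem_principal_downset_iff dest: transD)
  qed (use h in \<open>simp add: union_homs_def\<close>)
  with h principal show ?thesis
    by (auto simp: union_homs_def isotone_homs_def monotone_on_def principal_restriction_def)
qed

lemma downset_extension_closed:
  assumes \<S>: "\<And>\<A>. \<A> \<subseteq> \<S> \<Longrightarrow> \<Union>\<A> \<in> \<S>" and f: "f \<in> carrier (isotone_homs X r \<S>)"
  shows "downset_extension X r f \<in> carrier (union_homs (downsets X r) \<S>)"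
proof -
  have "\<Union>(f ` D) \<in> \<S>" if "D \<in> downsets X r" for D
    using f that by (intro \<S>) (auto simp: isotone_homs_def downsets_def)
  moreover have "downset_extension X r f (\<Union>\<A>) = \<Union>(downset_extension X r f ` \<A>)"
    if "\<A> \<subseteq> downsets X r" for \<A>
    using that Union_downsets_closed [OF that] by (auto simp: downset_extension_def subset_iff)
  ultimately show ?thesis
    by (simp add: union_homs_def) (simp add: downset_extension_def)
qed

lemma downset_extension_principal_restriction:
  assumes r: "preorder_on X r" and h: "h \<in> carrier (union_homs (downsets X r) \<S>)"
  shows "downset_extension X r (principal_restriction X r h) = h"
proof (rule extensionalityI)
  show "h \<in> extensional (downsets X r)" using h by (simp add: union_homs_def PiE_def)
  fix D assume D: "D \<in> downsets X r"
  then have "D \<subseteq> X" by (simp add: downsets_def)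
  with D have "downset_extension X r (principal_restriction X r h) D =
      \<Union>(h ` principal_downset r ` D)"
    by (auto simp: downset_extension_def principal_restriction_def)
  also have "\<dots> = h (\<Union>(principal_downset r ` D))"
    using h principal_downset_closed [OF r] by (simp add: union_homs_def image_subset_iff)
  also have "\<dots> = h D"
    using downset_eq_Union_principal_downsets [OF r D] by simp
  finally show "downset_extension X r (principal_restriction X r h) D = h D" .
qed (simp add: downset_extension_def)

lemma principal_restriction_downset_extension:
  assumes r: "preorder_on X r" and f: "f \<in> carrier (isotone_homs X r \<S>)"
  shows "principal_restriction X r (downset_extension X r f) = f"
proof (rule extensionalityI)
  show "f \<in> extensional X" using f by (simp add: isotone_homs_def PiE_def)
  fix x assume x: "x \<in> X"
  have "f x' \<subseteq> f x" if "x' \<in> principal_downset r x" for x'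
    using f r that by (auto simp: isotone_homs_def mem_principal_downset_iff preorder_on_def
        dest: monotone_onD)
  moreover have "x \<in> principal_downset r x"
    using r x by (simp add: mem_principal_downset_iff preorder_on_def refl_on_def)
  ultimately have "\<Union>(f ` principal_downset r x) = f x"
    by blast
  with r x show "principal_restriction X r (downset_extension X r f) x = f x"
    by (simp add: principal_restriction_def downset_extension_def principal_downset_closed
        del: UN_simps)
qed (simp add: principal_restriction_def)

lemma union_homs_downsets_order_isomorphic_isotone_homs:
  assumes r: "preorder_on X r" and \<S>: "\<And>\<A>. \<A> \<subseteq> \<S> \<Longrightarrow> \<Union>\<A> \<in> \<S>"
  shows "order_isomorphic (union_homs (downsets X r) \<S>) (isotone_homs X r \<S>)"
    (is "order_isomorphic ?L ?M")
proof (rule order_isomorphicI)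
  show "isotone ?L ?M (principal_restriction X r)"
    by (rule isotone_partial_orderI [OF partial_order_union_homs partial_order_isotone_homs])
      (simp add: union_homs_def isotone_homs_def principal_restriction_def
        principal_downset_closed [OF r])
  show "isotone ?M ?L (downset_extension X r)"
  proof (rule isotone_partial_orderI [OF partial_order_isotone_homs partial_order_union_homs])
    fix f g assume "f \<sqsubseteq>\<^bsub>?M\<^esub> g"
    then have "\<Union>(f ` D) \<subseteq> \<Union>(g ` D)" if "D \<in> downsets X r" for D
      using that by (fastforce simp: isotone_homs_def downsets_def)
    then show "downset_extension X r f \<sqsubseteq>\<^bsub>?L\<^esub> downset_extension X r g"
      by (simp add: union_homs_def downset_extension_def)
  qed
  show "principal_restriction X r \<in> carrier ?L \<rightarrow> carrier ?M"
    using principal_restriction_closed [OF r] by blast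
  show "downset_extension X r \<in> carrier ?M \<rightarrow> carrier ?L"
    using downset_extension_closed [OF \<S>] by blast
qed (rule downset_extension_principal_restriction [OF r]
      principal_restriction_downset_extension [OF r], assumption)+

section \<open>Stable relations\<close>

lemma mem_stable_relations_iff:
  "R \<in> carrier (stable_relations X r Y s) \<longleftrightarrow> R \<subseteq> X \<times> Y \<and>
    (\<forall>x x' y. (x, x') \<in> r \<longrightarrow> (x', y) \<in> R \<longrightarrow> (x, y) \<in> R) \<and>
    (\<forall>x y y'. (x, y) \<in> R \<longrightarrow> (y, y') \<in> s \<longrightarrow> (x, y') \<in> R)"
  unfolding stable_relations_def by fastforce

lemma partial_order_stable_relations: "partial_order (stable_relations X r Y s)"
  unfolding stable_relations_def by (rule partial_order_incl_order)

lemma complete_ring_of_sets_stable_relations: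
  assumes "r \<subseteq> X \<times> X" and "s \<subseteq> Y \<times> Y"
  shows "complete_ring_of_sets (carrier (stable_relations X r Y s)) (X \<times> Y)"
proof
  show "R \<subseteq> X \<times> Y" if "R \<in> carrier (stable_relations X r Y s)" for R
    using that by (simp add: mem_stable_relations_iff)
  show "\<Union>\<A> \<in> carrier (stable_relations X r Y s)"
    if "\<A> \<subseteq> carrier (stable_relations X r Y s)" for \<A>
    using that unfolding mem_stable_relations_iff subset_eq by blast
  show "X \<times> Y \<inter> \<Inter>\<A> \<in> carrier (stable_relations X r Y s)"
    if "\<A> \<subseteq> carrier (stable_relations X r Y s)" for \<A>
    using that assms unfolding mem_stable_relations_iff subset_eq by blast
qed

lemma superalgebraic_lattice_if_order_isomorphic_stable_relations:
  assumes "r \<subseteq> X \<times> X" and "s \<subseteq> Y \<times> Y"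
    and "partial_order L" and "order_isomorphic L (stable_relations X r Y s)"
  shows "superalgebraic_lattice L"
  using complete_ring_of_sets.superalgebraic_lattice_if_order_isomorphic
    [OF complete_ring_of_sets_stable_relations [OF assms(1,2)] assms(3)] assms(4)
  by (simp add: stable_relations_def)

lemma stable_relations_converse_order_isomorphic:
  "order_isomorphic (stable_relations Y (s\<inverse>) X (r\<inverse>)) (stable_relations X r Y s)"
proof (rule order_isomorphicI [where f = converse and g = converse])
  show "isotone (stable_relations Y (s\<inverse>) X (r\<inverse>)) (stable_relations X r Y s) converse"
    "isotone (stable_relations X r Y s) (stable_relations Y (s\<inverse>) X (r\<inverse>)) converse"
    by (rule isotone_partial_orderI [OF partial_order_stable_relations
          partial_order_stable_relations]; auto simp: stable_relations_def)+
qed (auto simp: mem_stable_relations_iff)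

lemma preorder_on_Un_stable_relation:
  assumes "preorder_on X r" and "preorder_on Y s" and "X \<inter> Y = {}"
    and R: "R \<in> carrier (stable_relations X r Y s)"
  shows "preorder_on (X \<union> Y) (r \<union> s \<union> R)"
proof -
  have r: "r \<subseteq> X \<times> X" "refl_on X r" "trans r" and s: "s \<subseteq> Y \<times> Y" "refl_on Y s" "trans s"
    using assms(1,2) by (simp_all add: preorder_on_def)
  have "trans (r \<union> s \<union> R)"
  proof (rule transI)
    fix a b c assume "(a, b) \<in> r \<union> s \<union> R" "(b, c) \<in> r \<union> s \<union> R"
    with R assms(3) r(1) s(1) transD [OF r(3), of a b c] transD [OF s(3), of a b c]
    show "(a, c) \<in> r \<union> s \<union> R"
      unfolding mem_stable_relations_iff by blast
  qed
  moreover have "refl_on (X \<union> Y) (r \<union> s \<union> R)"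
    using r(2) s(2) by (auto simp: refl_on_def)
  moreover have "r \<union> s \<union> R \<subseteq> (X \<union> Y) \<times> (X \<union> Y)"
    using R r(1) s(1) unfolding mem_stable_relations_iff by blast
  ultimately show ?thesis
    by (simp add: preorder_on_def)
qed

lemma partial_order_quasiorder_extensions: "partial_order (quasiorder_extensions X r Y s)"
  unfolding quasiorder_extensions_def by (rule partial_order_incl_order)

lemma mem_quasiorder_extensions_iff:
  "Q \<in> carrier (quasiorder_extensions X r Y s) \<longleftrightarrow> preorder_on (X \<union> Y) Q \<and>
    Q \<inter> (X \<times> X) = r \<and> Q \<inter> (Y \<times> Y) = s \<and> Q \<inter> (Y \<times> X) = {}"
  by (simp add: quasiorder_extensions_def)

lemma quasiorder_extension_Int_stable:
  assumes "Q \<in> carrier (quasiorder_extensions X r Y s)"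
  shows "Q \<inter> (X \<times> Y) \<in> carrier (stable_relations X r Y s)"
proof -
  have "trans Q" "Q \<inter> (X \<times> X) = r" "Q \<inter> (Y \<times> Y) = s"
    using assms by (simp_all add: mem_quasiorder_extensions_iff preorder_on_def)
  then show ?thesis
    unfolding mem_stable_relations_iff by (blast dest: transD)
qed

lemma quasiorder_extensions_order_isomorphic_stable_relations:
  assumes "preorder_on X r" and "preorder_on Y s" and "X \<inter> Y = {}"
  shows "order_isomorphic (quasiorder_extensions X r Y s) (stable_relations X r Y s)"
    (is "order_isomorphic ?L ?M")
proof (rule order_isomorphicI)
  let ?cross = "\<lambda>Q. Q \<inter> (X \<times> Y)" and ?glue = "\<lambda>R. r \<union> s \<union> R"
  have sub: "r \<subseteq> X \<times> X" "s \<subseteq> Y \<times> Y"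
    using assms(1,2) by (simp_all add: preorder_on_def)
  have orders: "partial_order ?L" "partial_order ?M"
    by (rule partial_order_quasiorder_extensions partial_order_stable_relations)+
  show "isotone ?L ?M ?cross"
    by (rule isotone_partial_orderI [OF orders])
      (auto simp: quasiorder_extensions_def stable_relations_def)
  show "isotone ?M ?L ?glue"
    by (rule isotone_partial_orderI [OF orders(2,1)])
      (auto simp: quasiorder_extensions_def stable_relations_def)
  show "?cross \<in> carrier ?L \<rightarrow> carrier ?M"
    using quasiorder_extension_Int_stable by blast
  show "?glue \<in> carrier ?M \<rightarrow> carrier ?L"
  proof
    fix R assume R: "R \<in> carrier ?M"
    then have "?glue R \<inter> (X \<times> X) = r" "?glue R \<inter> (Y \<times> Y) = s" "?glue R \<inter> (Y \<times> X) = {}"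
      using sub assms(3) unfolding mem_stable_relations_iff by blast+
    with preorder_on_Un_stable_relation [OF assms R] show "?glue R \<in> carrier ?L"
      by (simp add: mem_quasiorder_extensions_iff)
  qed
  show "?glue (?cross Q) = Q" if "Q \<in> carrier ?L" for Q
    using that unfolding mem_quasiorder_extensions_iff preorder_on_def by blast
  show "?cross (?glue R) = R" if "R \<in> carrier ?M" for R
    using that sub assms(3) unfolding mem_stable_relations_iff by blast
qed

lemma isotone_homs_order_isomorphic_stable_relations:
  assumes s: "s \<subseteq> Y \<times> Y"
  shows "order_isomorphic (isotone_homs Y s (downsets X r)) (stable_relations X r Y s)"
    (is "order_isomorphic ?L ?M")
proof (rule order_isomorphicI)
  let ?relation = "\<lambda>f. {(x, y). y \<in> Y \<and> x \<in> f y}" and ?columns = "\<lambda>R. \<lambda>y\<in>Y. R\<inverse> `` {y}"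
  have orders: "partial_order ?L" "partial_order ?M"
    by (rule partial_order_isotone_homs partial_order_stable_relations)+
  show "isotone ?L ?M ?relation"
    by (rule isotone_partial_orderI [OF orders])
      (auto simp: isotone_homs_def stable_relations_def)
  show "isotone ?M ?L ?columns"
    by (rule isotone_partial_orderI [OF orders(2,1)])
      (auto simp: isotone_homs_def stable_relations_def)
  show "?relation \<in> carrier ?L \<rightarrow> carrier ?M"
  proof
    fix f assume "f \<in> carrier ?L"
    then have f: "f y \<in> downsets X r" and mono: "(y, y') \<in> s \<Longrightarrow> f y \<subseteq> f y'"
      if "y \<in> Y" for y y'
      using s that by (auto simp: isotone_homs_def dest: monotone_onD)
    then show "?relation f \<in> carrier ?M"
      using s unfolding mem_stable_relations_iff downsets_def by blast
  qed
  show "?columns \<in> carrier ?M \<rightarrow> carrier ?L"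
    by (auto simp: mem_stable_relations_iff isotone_homs_def downsets_def monotone_on_def)
  show "?columns (?relation f) = f" if "f \<in> carrier ?L" for f
    using that by (intro extensionalityI [of _ Y]) (auto simp: isotone_homs_def PiE_def)
  show "?relation (?columns R) = R" if "R \<in> carrier ?M" for R
    using that by (auto simp: mem_stable_relations_iff)
qed

lemma union_homs_order_isomorphic_stable_relations:
  assumes "preorder_on Y s"
  shows "order_isomorphic (union_homs (downsets Y s) (downsets X r)) (stable_relations X r Y s)"
proof -
  have "order_isomorphic (union_homs (downsets Y s) (downsets X r))
      (isotone_homs Y s (downsets X r))"
    using assms Union_downsets_closed
    by (rule union_homs_downsets_order_isomorphic_isotone_homs)
  also have "order_isomorphic \<dots> (stable_relations X r Y s)"
    using assms by (intro isotone_homs_order_isomorphic_stable_relations)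
      (simp add: preorder_on_def)
  finally show ?thesis .
qed

section \<open>The six lattices\<close>

lemma isotone_downset_maps_eq: "isotone_downset_maps X r Y s = isotone_homs Y s (downsets X r)"
  by (simp add: isotone_downset_maps_def isotone_homs_def)

lemma antitone_upset_maps_eq:
  "antitone_upset_maps X r Y s = isotone_homs X (r\<inverse>) (downsets Y (s\<inverse>))"
  by (simp add: antitone_upset_maps_def isotone_homs_def downsets_converse monotone_on_def)
    meson

lemma union_preserving_maps_eq:
  "union_preserving_maps X r Y s = union_homs (downsets Y s) (downsets X r)"
  by (simp add: union_preserving_maps_def union_homs_def)

lemma partial_order_antitone_upset_maps: "partial_order (antitone_upset_maps X r Y s)"
  unfolding antitone_upset_maps_eq by (rule partial_order_isotone_homs)

lemma partial_order_upset_downset_tensor: "partial_order (upset_downset_tensor X r Y s)"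
  unfolding upset_downset_tensor_def
  by (rule partial_order_tensor_product [OF partial_order_incl_order])

lemma antitone_upset_maps_order_isomorphic_stable_relations:
  assumes "r \<subseteq> X \<times> X"
  shows "order_isomorphic (antitone_upset_maps X r Y s) (stable_relations X r Y s)"
proof -
  have "order_isomorphic (antitone_upset_maps X r Y s) (stable_relations Y (s\<inverse>) X (r\<inverse>))"
    unfolding antitone_upset_maps_eq
    by (rule isotone_homs_order_isomorphic_stable_relations) (use assms in auto)
  also note stable_relations_converse_order_isomorphic
  finally show ?thesis .
qed

lemma upset_downset_tensor_order_isomorphic_stable_relations:
  assumes r: "preorder_on X r" and s: "s \<subseteq> Y \<times> Y"
  shows "order_isomorphic (upset_downset_tensor X r Y s) (stable_relations X r Y s)"
proof -
  have "r \<subseteq> X \<times> X" using r by (simp add: preorder_on_def)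
  then have "order_isomorphic (upset_downset_tensor X r Y s)
      (union_homs (upsets X r) ((\<lambda>D. Y - D) ` downsets Y s))"
    unfolding upset_downset_tensor_def using s
    by (intro tensor_product_order_isomorphic_union_homs
        [OF complete_ring_of_sets_upsets complete_ring_of_sets_downsets])
  also have "union_homs (upsets X r) ((\<lambda>D. Y - D) ` downsets Y s) =
      union_homs (downsets X (r\<inverse>)) (downsets Y (s\<inverse>))"
    by (simp add: complements_of_downsets [OF s] downsets_converse)
  also have "order_isomorphic \<dots> (stable_relations Y (s\<inverse>) X (r\<inverse>))"
    using r by (intro union_homs_order_isomorphic_stable_relations) simp
  also note stable_relations_converse_order_isomorphic
  finally show ?thesis .
qed

theorem theorem2p1:
  fixes X Y :: "'a set" and r s :: "'a rel"
  assumes "partial_order_on X r"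
    and "partial_order_on Y s"
    and "X \<inter> Y = {}"
  shows "superalgebraic_lattice (quasiorder_extensions X r Y s) \<and>
    superalgebraic_lattice (isotone_downset_maps X r Y s) \<and>
    superalgebraic_lattice (antitone_upset_maps X r Y s) \<and>
    superalgebraic_lattice (union_preserving_maps X r Y s) \<and>
    superalgebraic_lattice (stable_relations X r Y s) \<and>
    superalgebraic_lattice (upset_downset_tensor X r Y s) \<and>
    order_isomorphic (quasiorder_extensions X r Y s) (isotone_downset_maps X r Y s) \<and>
    order_isomorphic (quasiorder_extensions X r Y s) (antitone_upset_maps X r Y s) \<and>
    order_isomorphic (quasiorder_extensions X r Y s) (union_preserving_maps X r Y s) \<and>
    order_isomorphic (quasiorder_extensions X r Y s) (stable_relations X r Y s) \<and>
    order_isomorphic (quasiorder_extensions X r Y s) (upset_downset_tensor X r Y s) \<and>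
    order_isomorphic (isotone_downset_maps X r Y s) (antitone_upset_maps X r Y s) \<and>
    order_isomorphic (isotone_downset_maps X r Y s) (union_preserving_maps X r Y s) \<and>
    order_isomorphic (isotone_downset_maps X r Y s) (stable_relations X r Y s) \<and>
    order_isomorphic (isotone_downset_maps X r Y s) (upset_downset_tensor X r Y s) \<and>
    order_isomorphic (antitone_upset_maps X r Y s) (union_preserving_maps X r Y s) \<and>
    order_isomorphic (antitone_upset_maps X r Y s) (stable_relations X r Y s) \<and>
    order_isomorphic (antitone_upset_maps X r Y s) (upset_downset_tensor X r Y s) \<and>
    order_isomorphic (union_preserving_maps X r Y s) (stable_relations X r Y s) \<and>
    order_isomorphic (union_preserving_maps X r Y s) (upset_downset_tensor X r Y s) \<and>
    order_isomorphic (stable_relations X r Y s) (upset_downset_tensor X r Y s)"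
proof -
  have r: "preorder_on X r" "r \<subseteq> X \<times> X" and s: "preorder_on Y s" "s \<subseteq> Y \<times> Y"
    using assms(1,2) by (simp_all add: partial_order_on_def preorder_on_def)
  note partial_orders = partial_order_quasiorder_extensions partial_order_isotone_homs
    partial_order_antitone_upset_maps partial_order_union_homs partial_order_stable_relations
    partial_order_upset_downset_tensor
  note isos = quasiorder_extensions_order_isomorphic_stable_relations [OF r(1) s(1) assms(3)]
    isotone_homs_order_isomorphic_stable_relations [OF s(2)]
    antitone_upset_maps_order_isomorphic_stable_relations [OF r(2)]
    union_homs_order_isomorphic_stable_relations [OF s(1)]
    order_isomorphic_refl [OF partial_order.axioms(1) [OF partial_order_stable_relations]]
    upset_downset_tensor_order_isomorphic_stable_relations [OF r(1) s(2)]
  note superalgebraic = superalgebraic_lattice_if_order_isomorphic_stable_relations [OF r(2) s(2)]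
  note via_stable_relations =
    order_isomorphic_trans [OF _ order_isomorphic_sym, where M = "stable_relations X r Y s"]
  show ?thesis
    unfolding isotone_downset_maps_eq union_preserving_maps_eq
    by (intro conjI superalgebraic partial_orders isos via_stable_relations)
qed

end
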